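(* If an inscribed triangle has three completely inscribed angles, then it does not have taxicab excircles at all three of its sides; that is, at least one side has no taxicab excircle.
   Context: All triangles are non-degenerate and lie in $\mathbb{R}^2$ with the taxicab distance $d((x_1,y_1),(x_2,y_2))=|x_1-x_2|+|y_1-y_2|$. A taxicab circle of center $P$ and radius $r>0$ is $\{Q: d(P,Q)=r\}$ (a square with sides of slope $\pm1$); its closed disk is $\{Q:d(P,Q)\le r\}$. Inscribed angles: an angle (of a triangle) with vertex $V$ is positively inscribed if the line of slope $+1$ through $V$ does not meet the interior of the angle, and negatively inscribed if the line of slope $-1$ through $V$ does not meet the interior of the angle. It is completely inscribed if it is both positively and negatively inscribed, and inscribed if it is at least one of the two. A triangle is an inscribed triangle if all of its angles are inscribed. Excircles: an excircle of a triangle at a side is a taxicab circle outside the triangle that is tangent to that side and tangent to both rays forming the angle of the triangle opposite that side. Precisely, for the side $\overline{AB}$ of $\triangle ABC$: its closed disk lies in the closed angular region $\angle ACB$ and in the closed half-plane bounded by line $AB$ not containing $C$, and the circle has at least one point in common with the segment $\overline{AB}$, with the ray from $C$ through $A$, and with the ray from $C$ through $B$ (contact may be at a corner of the circle, along a segment, or at a vertex of the triangle). *)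

theory Defs
  imports "HOL-Analysis.Analysis"
begin

type_synonym point = "real \<times> real"

definition taxi_dist :: "point \<Rightarrow> point \<Rightarrow> real" where
  "taxi_dist P Q = \<bar>fst P - fst Q\<bar> + \<bar>snd P - snd Q\<bar>"

definition taxi_circle :: "point \<Rightarrow> real \<Rightarrow> point set" where
  "taxi_circle P r = {Q. taxi_dist P Q = r}"

definition taxi_disk :: "point \<Rightarrow> real \<Rightarrow> point set" where
  "taxi_disk P r = {Q. taxi_dist P Q \<le> r}"

definition triangle :: "point \<Rightarrow> point \<Rightarrow> point \<Rightarrow> bool" where
  "triangle A B C \<longleftrightarrow> \<not> collinear {A, B, C}"

definition slope_line :: "real \<Rightarrow> point \<Rightarrow> point set" where
  "slope_line m V = {Q. snd Q - snd V = m * (fst Q - fst V)}"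

definition ray :: "point \<Rightarrow> point \<Rightarrow> point set" where
  "ray V P = {V + t *\<^sub>R (P - V) | t. 0 \<le> t}"

text \<open>The first argument of the following notions is the vertex of the angle; the other two are
  points on its sides, assumed not collinear with the vertex.\<close>

definition angle_region :: "point \<Rightarrow> point \<Rightarrow> point \<Rightarrow> point set" where
  "angle_region V P Q = {V + s *\<^sub>R (P - V) + t *\<^sub>R (Q - V) | s t. 0 \<le> s \<and> 0 \<le> t}"

definition angle_interior :: "point \<Rightarrow> point \<Rightarrow> point \<Rightarrow> point set" where
  "angle_interior V P Q = {V + s *\<^sub>R (P - V) + t *\<^sub>R (Q - V) | s t. 0 < s \<and> 0 < t}"

definition positively_inscribed :: "point \<Rightarrow> point \<Rightarrow> point \<Rightarrow> bool" where
  "positively_inscribed V P Q \<longleftrightarrow> slope_line 1 V \<inter> angle_interior V P Q = {}"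

definition negatively_inscribed :: "point \<Rightarrow> point \<Rightarrow> point \<Rightarrow> bool" where
  "negatively_inscribed V P Q \<longleftrightarrow> slope_line (- 1) V \<inter> angle_interior V P Q = {}"

definition completely_inscribed :: "point \<Rightarrow> point \<Rightarrow> point \<Rightarrow> bool" where
  "completely_inscribed V P Q \<longleftrightarrow> positively_inscribed V P Q \<and> negatively_inscribed V P Q"

definition inscribed :: "point \<Rightarrow> point \<Rightarrow> point \<Rightarrow> bool" where
  "inscribed V P Q \<longleftrightarrow> positively_inscribed V P Q \<or> negatively_inscribed V P Q"

definition inscribed_triangle :: "point \<Rightarrow> point \<Rightarrow> point \<Rightarrow> bool" where
  "inscribed_triangle A B C \<longleftrightarrow>
     triangle A B C \<and> inscribed A B C \<and> inscribed B C A \<and> inscribed C A B"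

text \<open>The closed half-plane bounded by the line \<open>AB\<close> on the side away from \<open>C\<close>, for \<open>C\<close> off
  that line: points of the line, displaced by a nonnegative multiple of the direction from \<open>C\<close>
  to \<open>A\<close>.\<close>

definition far_half_plane :: "point \<Rightarrow> point \<Rightarrow> point \<Rightarrow> point set" where
  "far_half_plane A B C = {A + s *\<^sub>R (B - A) + t *\<^sub>R (A - C) | s t. 0 \<le> t}"

text \<open>Excircles at the side \<open>AB\<close> of the triangle \<open>ABC\<close>. Tangency is containment of the disk on the
  correct side together with contact, because a taxicab circle may touch a line at a corner or
  along a whole segment.\<close>

definition is_excircle ::
    "point \<Rightarrow> real \<Rightarrow> point \<Rightarrow> point \<Rightarrow> point \<Rightarrow> bool" where
  "is_excircle P r A B C \<longleftrightarrow>
     0 < r \<and>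
     taxi_disk P r \<subseteq> angle_region C A B \<and>
     taxi_disk P r \<subseteq> far_half_plane A B C \<and>
     taxi_circle P r \<inter> closed_segment A B \<noteq> {} \<and>
     taxi_circle P r \<inter> ray C A \<noteq> {} \<and>
     taxi_circle P r \<inter> ray C B \<noteq> {}"

definition has_excircle_at :: "point \<Rightarrow> point \<Rightarrow> point \<Rightarrow> bool" where
  "has_excircle_at A B C \<longleftrightarrow> (\<exists>P r. is_excircle P r A B C)"

end

theory Submission
  imports Defs
begin

text \<open>In the coordinates \<open>y - x\<close> and \<open>y + x\<close> the taxicab metric is the maximum metric, and three
  completely inscribed angles force two vertices to agree in the first coordinate and two in the
  second: the triangle has a right angle, at \<open>C\<close> say, with legs of slope \<open>1\<close> and \<open>-1\<close>. A taxicab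
  circle meeting both of the rays from \<open>C\<close> along the legs has \<open>C\<close> in its closed disk, so the disk
  does not lie beyond the hypotenuse.\<close>

lemma slope_line_inter_angle_interior_empty:
  assumes "slope_line m V \<inter> angle_interior V P Q = {}"
  shows "0 \<le> ((snd P - m * fst P) - (snd V - m * fst V)) * ((snd Q - m * fst Q) - (snd V - m * fst V))"
proof (rule ccontr)
  define p where "p = (snd P - m * fst P) - (snd V - m * fst V)"
  define q where "q = (snd Q - m * fst Q) - (snd V - m * fst V)"
  assume "\<not> ?thesis"
  then have neg: "p * q < 0" by (simp add: p_def q_def)
  \<comment> \<open>The offsets \<open>p\<close> and \<open>q\<close> from the line have opposite
    signs. Weighting each direction by the size of the other offset makes them cancel, which yields
    a point of the line interior to the angle.\<close>
  define X where "X = V + \<bar>q\<bar> *\<^sub>R (P - V) + \<bar>p\<bar> *\<^sub>R (Q - V)"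
  have "0 < \<bar>q\<bar>" "0 < \<bar>p\<bar>" using neg by auto
  then have "X \<in> angle_interior V P Q"
    unfolding angle_interior_def X_def by blast
  moreover have "\<bar>q\<bar> * p + \<bar>p\<bar> * q = 0"
    using neg by (auto simp: mult_less_0_iff)
  then have "X \<in> slope_line m V"
    by (simp add: slope_line_def X_def p_def q_def algebra_simps)
  ultimately show False using assms by blast
qed

text \<open>If the three numbers were distinct, the middle one would see the other two on opposite
  sides, and its product would be negative.\<close>

lemma two_of_three_equal:
  fixes a b c :: real
  assumes "0 \<le> (b - a) * (c - a)" "0 \<le> (c - b) * (a - b)" "0 \<le> (a - c) * (b - c)"
  shows "a = b \<or> b = c \<or> c = a"
  using assms by (auto simp: zero_le_mult_iff)

lemma completely_inscribed_two_equal: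
  assumes "completely_inscribed A B C" "completely_inscribed B C A" "completely_inscribed C A B"
    and m: "m = 1 \<or> m = -1"
  defines "w \<equiv> \<lambda>X::point. snd X - m * fst X"
  shows "w A = w B \<or> w B = w C \<or> w C = w A"
  unfolding w_def
  by (rule two_of_three_equal; rule slope_line_inter_angle_interior_empty)
    (use assms(1-4) in
      \<open>auto simp: completely_inscribed_def positively_inscribed_def negatively_inscribed_def\<close>)

text \<open>Membership would give an equation in which \<open>C\<close> has total coefficient
  \<open>1 + t\<close>, which is positive. Solving for \<open>C\<close> places it on the line
  through \<open>A\<close> and \<open>B\<close>.\<close>

lemma apex_notin_far_half_plane:
  assumes "triangle A B C"
  shows "C \<notin> far_half_plane A B C"
proof
  assume "C \<in> far_half_plane A B C"
  then obtain s t where C: "C = A + s *\<^sub>R (B - A) + t *\<^sub>R (A - C)" and t: "0 \<le> t"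
    by (auto simp: far_half_plane_def)
  from C have "(1 + t) *\<^sub>R C = (1 + t) *\<^sub>R A + s *\<^sub>R (B - A)"
    by (simp add: algebra_simps)
  then have "C = inverse (1 + t) *\<^sub>R ((1 + t) *\<^sub>R A + s *\<^sub>R (B - A))"
    using t by (metis add_nonneg_pos add.commute less_irrefl scaleR_left_imp_eq scaleR_scaleR
        right_inverse scaleR_one zero_less_one)
  then have "C = (1 - s / (1 + t)) *\<^sub>R A + (1 - (1 - s / (1 + t))) *\<^sub>R B"
    using t by (simp add: scaleR_right_distrib scaleR_right_diff_distrib scaleR_left_diff_distrib
        divide_inverse_commute)
  then have "collinear {A, C, B}"
    unfolding collinear_3_expand by blast
  with assms show False by (simp add: triangle_def insert_commute)
qed

lemma ray_slope:
  assumes "Q \<in> ray V P" "snd P - m * fst P = snd V - m * fst V"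
  shows "snd Q - m * fst Q = snd V - m * fst V"
proof -
  obtain t where Q: "Q = V + t *\<^sub>R (P - V)"
    using assms(1) by (auto simp: ray_def)
  then have "(snd Q - m * fst Q) - (snd V - m * fst V)
      = t * ((snd P - m * fst P) - (snd V - m * fst V))"
    by (simp add: Q algebra_simps)
  then show ?thesis using assms(2) by simp
qed

lemma no_excircle_at_hypotenuse:
  assumes tri: "triangle A B C"
    and A: "snd A - fst A = snd C - fst C"
    and B: "snd B + fst B = snd C + fst C"
  shows "\<not> has_excircle_at A B C"
proof
  assume "has_excircle_at A B C"
  then obtain P r D E where far: "taxi_disk P r \<subseteq> far_half_plane A B C"
    and D: "D \<in> taxi_circle P r" "D \<in> ray C A"
    and E: "E \<in> taxi_circle P r" "E \<in> ray C B"
    unfolding has_excircle_at_def is_excircle_def by blast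
  have "snd D - fst D = snd C - fst C" "snd E + fst E = snd C + fst C"
    using ray_slope[OF D(2), of 1] ray_slope[OF E(2), of "-1"] A B by auto
  \<comment> \<open>The distance from \<open>P\<close> to \<open>C\<close> is the larger of the
    differences in \<open>y - x\<close> and \<open>y + x\<close>. The first is shared with
    \<open>D\<close> and the second with \<open>E\<close>, so neither exceeds
    \<open>r\<close>.\<close>
  then have "C \<in> taxi_disk P r"
    using D(1) E(1) unfolding taxi_circle_def taxi_disk_def taxi_dist_def mem_Collect_eq
    by linarith
  with far apex_notin_far_half_plane[OF tri] show False by blast
qed

lemma far_half_plane_commute: "far_half_plane A B C = far_half_plane B A C"
proof -
  have "far_half_plane A B C \<subseteq> far_half_plane B A C" for A B :: point
  proof
    fix X assume "X \<in> far_half_plane A B C"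
    then obtain s t where "X = A + s *\<^sub>R (B - A) + t *\<^sub>R (A - C)" and t: "0 \<le> t"
      by (auto simp: far_half_plane_def)
    then have "X = B + (1 - s + t) *\<^sub>R (A - B) + t *\<^sub>R (B - C)"
      by (simp add: algebra_simps)
    with t show "X \<in> far_half_plane B A C"
      unfolding far_half_plane_def by blast
  qed
  then show ?thesis by blast
qed

lemma angle_region_commute: "angle_region V P Q = angle_region V Q P"
  unfolding angle_region_def by (rule Collect_cong) (metis add.commute add.left_commute)

text \<open>The right angle can have its leg of slope 1 towards either of the other two vertices, so
  both orders of the endpoints of the hypotenuse occur.\<close>

lemma has_excircle_at_commute: "has_excircle_at A B C \<longleftrightarrow> has_excircle_at B A C"
  unfolding has_excircle_at_def is_excircle_def far_half_plane_commute[of A B]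
    angle_region_commute[of C A] closed_segment_commute[of A B]
  by blast

theorem lemma4:
  fixes A B C :: point
  assumes "inscribed_triangle A B C"
    and "completely_inscribed A B C"
    and "completely_inscribed B C A"
    and "completely_inscribed C A B"
  shows "\<not> (has_excircle_at A B C \<and> has_excircle_at B C A \<and> has_excircle_at C A B)"
proof -
  have tri: "triangle A B C" "triangle B C A" "triangle C A B"
    "triangle B A C" "triangle C B A" "triangle A C B"
    using assms(1) by (simp_all add: inscribed_triangle_def triangle_def insert_commute)
  then have ne: "A \<noteq> B" "B \<noteq> C" "C \<noteq> A"
    by (auto simp: triangle_def)
  have eq: "X = Y" if "snd X - fst X = snd Y - fst Y" "snd X + fst X = snd Y + fst Y"
    for X Y :: point
    using that by (simp add: prod_eq_iff)
  have "snd A - fst A = snd B - fst B \<or> snd B - fst B = snd C - fst C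
      \<or> snd C - fst C = snd A - fst A"
    using completely_inscribed_two_equal[OF assms(2-4), of 1] by simp
  moreover have "snd A + fst A = snd B + fst B \<or> snd B + fst B = snd C + fst C
      \<or> snd C + fst C = snd A + fst A"
    using completely_inscribed_two_equal[OF assms(2-4), of "-1"] by simp
  \<comment> \<open>The same pair cannot agree in both coordinates, since its vertices would
    coincide. Two different pairs share a vertex, which is the right angle, and the opposite side
    has no excircle.\<close>
  ultimately show ?thesis
    using ne eq tri[THEN no_excircle_at_hypotenuse] has_excircle_at_commute by metis
qed

end
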